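(* Let $a\in\mathbb{R}$, $f \colon [a,\infty) \to \mathbb{R}$, and suppose there exist a point $t_0 \in [a,\infty)$ and a number $\alpha \in (0, 1)$ such that the conformable derivative $T^{\alpha}_a f(t_0)$ with lower terminal $a$ exists. Then the conformable derivative $T^{\beta}_a f(t_0)$ exists for every $\beta \in (0, 1]$ with $\beta \neq \alpha$, and $$T^{\alpha}_a f(t_0) = (t_0 - a)^{\beta-\alpha}\,T^{\beta}_a f(t_0),$$ except that in the case when $t_0=a$ and $\beta < \alpha$ this formula is replaced by $$T^{\beta}_a f(t_0) = (t_0 - a)^{\alpha-\beta}\,T^{\alpha}_a f(t_0).$$
   Context: Let $a\in\mathbb{R}$ (the lower terminal) and $f\colon[a,\infty)\to\mathbb{R}$. The conformable derivative $T_a^\alpha f$ of order $\alpha\in(0,1]$ is defined as follows. (1) For $t\in(a,\infty)$: $T^{\alpha}_a f(t) = \lim_{\theta \to 0}\frac{f(t+\theta(t-a)^{1-\alpha}) - f(t)}{\theta}$, if the (finite) limit exists. (2) At $t=a$: $T_a^\alpha f(a)$ exists if and only if the right first derivative $f'(a)$ of $f$ at $a$ exists, and then $T_a^1 f(a)=f'(a)$, while $T_a^\alpha f(a)=0$ for $\alpha\in(0,1)$. For a real exponent $p>0$, $0^p=0$. *)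

theory Defs
  imports Complex_Main
begin

(* A function [a, oo) -> R is a total function on the reals whose values left of a are
   irrelevant: for t > a the limit only sees points near t, and at t = a only the one-sided
   derivative is taken. *)
definition has_conformable_derivative ::
  "real \<Rightarrow> real \<Rightarrow> (real \<Rightarrow> real) \<Rightarrow> real \<Rightarrow> real \<Rightarrow> bool" where
  "has_conformable_derivative a \<alpha> f t D \<longleftrightarrow>
     (a < t \<and> ((\<lambda>\<theta>. (f (t + \<theta> * (t - a) powr (1 - \<alpha>)) - f t) / \<theta>) \<longlongrightarrow> D) (at 0)) \<or>
     (t = a \<and> (\<exists>d. (f has_real_derivative d) (at_right a) \<and> D = (if \<alpha> = 1 then d else 0)))"

definition conformable_differentiable ::
  "real \<Rightarrow> real \<Rightarrow> (real \<Rightarrow> real) \<Rightarrow> real \<Rightarrow> bool" where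
  "conformable_differentiable a \<alpha> f t \<longleftrightarrow> (\<exists>D. has_conformable_derivative a \<alpha> f t D)"

definition conformable_derivative ::
  "real \<Rightarrow> real \<Rightarrow> (real \<Rightarrow> real) \<Rightarrow> real \<Rightarrow> real" where
  "conformable_derivative a \<alpha> f t = (THE D. has_conformable_derivative a \<alpha> f t D)"

end

theory Submission
  imports Defs
begin

text \<open>For t > a, the substitution h = \<theta> (t - a)^(1-\<alpha>) turns the conformable
  difference quotient into the ordinary one times the positive constant (t - a)^(1-\<alpha>). So the
  conformable derivative exists iff f'(t) does, whatever the order, and it equals (t -
  a)^(1-\<alpha>) f'(t) (\<open>has_conformable_derivative_iff_DERIV\<close>). Eliminating f'(t)
  between two orders gives the formula. At t = a, existence means a right derivative for every
  order, and the value is 0 for orders below 1; since 0^p = 0, both sides of the relevant formula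
  vanish.\<close>

text \<open>The conformable quotient is the difference quotient at 0 of \<open>g\<close>, which is f
  composed with an affine map of slope c. As c > 0, this map is invertible, and the chain rule
  applies in both directions.\<close>

lemma has_conformable_derivative_iff_DERIV:
  assumes "a < t"
  shows "has_conformable_derivative a \<alpha> f t D \<longleftrightarrow> DERIV f t :> (t - a) powr (\<alpha> - 1) * D"
proof -
  define c where "c = (t - a) powr (1 - \<alpha>)"
  define g where "g = (\<lambda>\<theta>. f (t + \<theta> * c))"
  have c: "c > 0" "(t - a) powr (\<alpha> - 1) = inverse c"
    using assms by (simp_all add: c_def flip: powr_minus)
  have "has_conformable_derivative a \<alpha> f t D \<longleftrightarrow> DERIV g 0 :> D"
    using assms by (simp add: has_conformable_derivative_def DERIV_def g_def c_def)
  also have "\<dots> \<longleftrightarrow> DERIV f t :> inverse c * D"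
  proof
    assume g': "DERIV g 0 :> D"
    \<comment> \<open>This is the inverse affine map; composing \<open>g\<close> with it gives back
      f.\<close>
    have "DERIV (\<lambda>x. (x - t) / c) t :> inverse c"
      using c by (auto intro!: derivative_eq_intros simp: field_simps)
    then have "DERIV (\<lambda>x. g ((x - t) / c)) t :> D * inverse c"
      using g' by (intro DERIV_chain2[where f = g and g = "\<lambda>x. (x - t) / c"]) simp_all
    then show "DERIV f t :> inverse c * D"
      using c by (simp add: g_def mult.commute)
  next
    assume f': "DERIV f t :> inverse c * D"
    have "DERIV (\<lambda>\<theta>. t + \<theta> * c) 0 :> c"
      by (auto intro!: derivative_eq_intros)
    then have "DERIV g 0 :> inverse c * D * c"
      unfolding g_def using f' by (intro DERIV_chain2[where f = f and g = "\<lambda>\<theta>. t + \<theta> * c"]) simp_all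
    moreover have "inverse c * D * c = D"
      using c by simp
    ultimately show "DERIV g 0 :> D"
      by metis
  qed
  finally show ?thesis
    by (simp add: c)
qed

text \<open>Uniqueness of the ordinary derivative passes to D because the factor (t -
  a)^(\<alpha>-1) is nonzero.\<close>

lemma conformable_derivative_eqI:
  assumes "a < t" "has_conformable_derivative a \<alpha> f t D"
  shows "conformable_derivative a \<alpha> f t = D"
  unfolding conformable_derivative_def
proof (rule the_equality)
  fix E assume "has_conformable_derivative a \<alpha> f t E"
  with assms show "E = D"
    using DERIV_unique by (force simp: has_conformable_derivative_iff_DERIV)
qed (fact assms)

lemma conformable_derivative_lower_terminal:
  assumes "\<alpha> \<noteq> 1" "conformable_differentiable a \<alpha> f a"
  shows "conformable_derivative a \<alpha> f a = 0"
  using assms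
  by (auto simp: conformable_differentiable_def conformable_derivative_def
      has_conformable_derivative_def)

lemma conformable_differentiable_lower_terminal_iff:
  "conformable_differentiable a \<alpha> f a \<longleftrightarrow> (\<exists>d. (f has_real_derivative d) (at_right a))"
  by (auto simp: conformable_differentiable_def has_conformable_derivative_def)

theorem theorem5p3:
  fixes a t0 \<alpha> :: real and f :: "real \<Rightarrow> real"
  assumes "t0 \<in> {a..}"
    and "\<alpha> \<in> {0<..<1}"
    and "conformable_differentiable a \<alpha> f t0"
  shows "\<forall>\<beta>\<in>{0<..1}. \<beta> \<noteq> \<alpha> \<longrightarrow>
           conformable_differentiable a \<beta> f t0 \<and>
           (if t0 = a \<and> \<beta> < \<alpha>
            then conformable_derivative a \<beta> f t0
                   = (t0 - a) powr (\<alpha> - \<beta>) * conformable_derivative a \<alpha> f t0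
            else conformable_derivative a \<alpha> f t0
                   = (t0 - a) powr (\<beta> - \<alpha>) * conformable_derivative a \<beta> f t0)"
proof (intro ballI impI)
  fix \<beta> :: real
  assume "\<beta> \<in> {0<..1}" "\<beta> \<noteq> \<alpha>"
  show "conformable_differentiable a \<beta> f t0 \<and>
           (if t0 = a \<and> \<beta> < \<alpha>
            then conformable_derivative a \<beta> f t0
                   = (t0 - a) powr (\<alpha> - \<beta>) * conformable_derivative a \<alpha> f t0
            else conformable_derivative a \<alpha> f t0
                   = (t0 - a) powr (\<beta> - \<alpha>) * conformable_derivative a \<beta> f t0)"
  proof (cases "t0 = a")
    case True
    then have "conformable_differentiable a \<beta> f a"
      using assms(3) by (simp add: conformable_differentiable_lower_terminal_iff)
    \<comment> \<open>The left-hand side is a derivative of order below 1, hence 0, and the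
      right-hand side has a factor \<open>0 powr _\<close>, which is 0. So for \<beta> = 1 the value
      of the right derivative does not matter.\<close>
    with True show ?thesis
      using assms conformable_derivative_lower_terminal[of \<alpha> a f]
        conformable_derivative_lower_terminal[of \<beta> a f] by auto
  next
    case False
    with assms(1) have t0: "a < t0" by simp
    from assms(3) obtain D where D: "has_conformable_derivative a \<alpha> f t0 D"
      by (auto simp: conformable_differentiable_def)
    \<comment> \<open>The value is forced: D and E must yield the same ordinary derivative of f at
      \<open>t0\<close>.\<close>
    define E where "E = (t0 - a) powr (\<alpha> - \<beta>) * D"
    have "(t0 - a) powr (\<beta> - 1) * E = (t0 - a) powr (\<alpha> - 1) * D"
      by (simp add: E_def flip: mult.assoc powr_add)
    with D t0 have E: "has_conformable_derivative a \<beta> f t0 E"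
      by (simp add: has_conformable_derivative_iff_DERIV)
    have "D = (t0 - a) powr (\<beta> - \<alpha>) * E"
      using t0 by (simp add: E_def flip: mult.assoc powr_add)
    with False D E t0 show ?thesis
      by (auto simp: conformable_differentiable_def conformable_derivative_eqI)
  qed
qed

end
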